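(* Let $\delta>0$ and let $\alpha: [0,\delta)\to[0,\alpha(\delta))$ be a concave homeomorphism, where $\alpha(\delta):=\lim_{x\to\delta^-}\alpha(x)$. Then there exists a concave modulus $\beta:[0,\infty)\to[0,\infty)$ such that $\alpha$ and $\beta$ have the same germs at $0$. Moreover, the following hold. (1) The map $\beta$ can be chosen to be a sup-tame modulus if $\lim_{t\to0+}\sup_{0<x<\delta} t\alpha(x)/\alpha(tx)=0$. (2) The map $\beta$ can be chosen to be a sub-tame modulus if $\lim_{t\to0+}\sup_{0<x<\delta} \alpha(tx)/\alpha(x)=0$.
   Context: A concave modulus is a homeomorphism $\beta:[0,\infty)\to[0,\infty)$ that is concave as a function. It is sup-tame if $\lim_{t\to 0+}\sup_{x>0} t\beta(x)/\beta(tx)=0$, and sub-tame if $\lim_{t\to 0+}\sup_{x>0}\beta(tx)/\beta(x)=0$. Two maps $f,g$ defined near $0$ (in $[0,\infty)$) have the same germs at $0$ if $f(x)=g(x)$ for all $x$ sufficiently near $0$. *)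

theory Defs
  imports "HOL-Analysis.Analysis"
begin

text \<open>
  Functions defined on a half-line or interval are modelled by total functions
  \<open>real \<Rightarrow> real\<close> of which only the values on the intended domain are ever constrained or used.
\<close>

definition concave_modulus :: "(real \<Rightarrow> real) \<Rightarrow> bool" where
  "concave_modulus \<beta> \<longleftrightarrow> (\<exists>\<gamma>. homeomorphism {0..} {0..} \<beta> \<gamma>) \<and> concave_on {0..} \<beta>"

text \<open>
  Suprema are taken in the extended reals, so that they always have their intended meaning
  (a real-valued \<open>Sup\<close> is unspecified on unbounded sets).
\<close>

definition sup_tame_modulus :: "(real \<Rightarrow> real) \<Rightarrow> bool" where
  "sup_tame_modulus \<beta> \<longleftrightarrow> concave_modulus \<beta> \<and>
     ((\<lambda>t. SUP x\<in>{0<..}. ereal (t * \<beta> x / \<beta> (t * x))) \<longlongrightarrow> 0) (at_right 0)"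

definition sub_tame_modulus :: "(real \<Rightarrow> real) \<Rightarrow> bool" where
  "sub_tame_modulus \<beta> \<longleftrightarrow> concave_modulus \<beta> \<and>
     ((\<lambda>t. SUP x\<in>{0<..}. ereal (\<beta> (t * x) / \<beta> x)) \<longlongrightarrow> 0) (at_right 0)"

text \<open>Agreement on a one-sided neighbourhood of 0 in \<open>[0,\<infinity>)\<close>, the point 0 included.\<close>

definition same_germs_at_0 :: "(real \<Rightarrow> real) \<Rightarrow> (real \<Rightarrow> real) \<Rightarrow> bool" where
  "same_germs_at_0 f g \<longleftrightarrow> (\<exists>\<epsilon>>0. \<forall>x\<in>{0..<\<epsilon>}. f x = g x)"

end

theory Submission
  imports Defs
begin

text \<open>
  Fix \<open>0 < a < b < \<delta>\<close> and let \<open>s > 0\<close> be the slope of the secant of \<open>\<alpha>\<close> over \<open>[a, b]\<close>.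
  Keep \<open>\<alpha>\<close> on \<open>[0, a]\<close> and continue it beyond \<open>a\<close> by the power function
  \<open>\<alpha> a * (x / a) powr p\<close>, where \<open>0 < p < 1\<close> is so small that the slope \<open>p * \<alpha> a / a\<close> of
  that power function at \<open>a\<close> is at most \<open>s\<close>.  Both pieces are concave and lie below the line
  of slope \<open>s\<close> through \<open>(a, \<alpha> a)\<close>, so the extension \<open>\<beta>\<close> is concave
  (\<open>concave_on_glue\<close>, \<open>concave_on_power_extension\<close>).  It is a homeomorphism of the half-line,
  because the inverse of \<open>\<alpha>\<close> can be continued by the inverse power
  (\<open>homeomorphism_power_extension\<close>).

  The same \<open>\<beta>\<close> serves for all three claims.  Let \<open>Q t x\<close> be one of the two quotients
  \<open>t * \<beta> x / \<beta> (t * x)\<close> and \<open>\<beta> (t * x) / \<beta> x\<close>.  By concavity and monotonicity respectively,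
  \<open>0 \<le> Q t x \<le> 1\<close> for \<open>0 < t < 1\<close>; moreover
  \<open>Q (u * u) x = Q u (u * x) * Q u x\<close>.  If \<open>u * x < a\<close>, the first factor is a quotient of
  \<open>\<alpha>\<close>; if \<open>u * x \<ge> a\<close>, both arguments of \<open>\<beta>\<close> in the second factor lie in the range of the power
  function, and that factor equals \<open>u powr c\<close> with \<open>c = 1 - p\<close> or \<open>c = p\<close>.  So for
  \<open>t = u * u\<close> the supremum of \<open>Q t\<close> is at most the maximum of the supremum for \<open>\<alpha>\<close> at
  \<open>u\<close> and \<open>u powr c\<close>, and both tend to 0 (\<open>tendsto_SUP_cocycle\<close>).
\<close>

section \<open>Gluing concave functions and extending by a power\<close>

text \<open>Two concave functions that meet at \<open>a\<close> form a concave function as soon as one line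
  through the common point lies above both.\<close>

lemma concave_on_glue:
  fixes f g :: "real \<Rightarrow> real"
  assumes S: "convex S" and a: "a \<in> S"
    and f: "concave_on (S \<inter> {..a}) f" and g: "concave_on (S \<inter> {a..}) g"
    and eq: "g a = f a"
    and fL: "\<And>x. x \<in> S \<Longrightarrow> x \<le> a \<Longrightarrow> f x \<le> f a + s * (x - a)"
    and gL: "\<And>x. x \<in> S \<Longrightarrow> a \<le> x \<Longrightarrow> g x \<le> f a + s * (x - a)"
  shows "concave_on S (\<lambda>x. if x \<le> a then f x else g x)"
proof
  fix t x y :: real
  assume t: "0 < t" "t < 1" and x: "x \<in> S" and y: "y \<in> S" and xy: "x < y"
  let ?h = "\<lambda>x. if x \<le> a then f x else g x"
  define z where "z = (1 - t) * x + t * y"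
  have "0 < t * (y - x)" "0 < (1 - t) * (y - x)" using t xy by auto
  then have xz: "x < z" and zy: "z < y" by (auto simp: z_def algebra_simps)
  have "(1 - t) * ?h x + t * ?h y \<le> ?h z"
  proof (cases "y \<le> a \<or> a < x")
    case True
    then show ?thesis
      using xz zy concave_onD[OF f, of t x y] concave_onD[OF g, of t x y] t x y xy
      by (auto simp: z_def)
  next
    case False
    then have xa: "x \<le> a" and ay: "a < y" by auto
    have fx: "f x \<le> f a - s * (a - x)" using fL[OF x xa] by (simp add: algebra_simps)
    have gy: "g y \<le> f a + s * (y - a)" using gL[OF y] ay by simp
    show ?thesis
    proof (cases "z \<le> a")
      case True
      then have "x < a" using xz by simp
      \<comment> \<open>Here \<open>z\<close> lies between \<open>x\<close> and \<open>a\<close>, with weight \<open>k \<ge> t\<close> at \<open>a\<close>.\<close>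
      define k where "k = (z - x) / (a - x)"
      have k: "0 \<le> k" "k \<le> 1" using xz True \<open>x < a\<close> by (auto simp: k_def)
      have kz: "k * (a - x) = z - x" using \<open>x < a\<close> by (simp add: k_def)
      have kt: "(k - t) * (a - x) = t * (y - a)" using kz by (simp add: z_def algebra_simps)
      have "0 \<le> (k - t) * (a - x)" unfolding kt using t ay by simp
      then have "t \<le> k" using \<open>x < a\<close> by (simp add: zero_le_mult_iff)
      have "(1 - k) * x + k * a = z" using kz by (simp add: algebra_simps)
      then have "(1 - k) * f x + k * f a \<le> f z"
        using concave_onD[OF f k, of x a] x a xa by simp
      moreover have "(k - t) * (s * (a - x)) \<le> (k - t) * (f a - f x)"
        using \<open>t \<le> k\<close> fx by (intro mult_left_mono) auto
      moreover have "(k - t) * (s * (a - x)) = t * (s * (y - a))"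
        using kt by (metis mult.left_commute)
      moreover have "t * g y \<le> t * (f a + s * (y - a))"
        using t gy by (intro mult_left_mono) auto
      ultimately have "(1 - t) * f x + t * g y \<le> f z" by (simp add: algebra_simps)
      then show ?thesis using xa ay True by simp
    next
      case False
      \<comment> \<open>Here \<open>z\<close> lies between \<open>a\<close> and \<open>y\<close>, with weight \<open>k \<ge> 1 - t\<close> at \<open>a\<close>.\<close>
      define k where "k = (y - z) / (y - a)"
      have k: "0 \<le> k" "k \<le> 1" using zy False ay by (auto simp: k_def)
      have kz: "k * (y - a) = y - z" using ay by (simp add: k_def)
      have kt: "(k - (1 - t)) * (y - a) = (1 - t) * (a - x)"
        using kz by (simp add: z_def algebra_simps)
      have "0 \<le> (k - (1 - t)) * (y - a)" unfolding kt using t xa by simp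
      then have "1 - t \<le> k" using ay by (simp add: zero_le_mult_iff)
      have "(1 - k) * y + k * a = z" using kz by (simp add: algebra_simps)
      then have "(1 - k) * g y + k * f a \<le> g z"
        using concave_onD[OF g k, of y a] y a ay eq by simp
      moreover have "(k - (1 - t)) * (g y - f a) \<le> (k - (1 - t)) * (s * (y - a))"
        using \<open>1 - t \<le> k\<close> gy by (intro mult_left_mono) auto
      moreover have "(k - (1 - t)) * (s * (y - a)) = (1 - t) * (s * (a - x))"
        using kt by (metis mult.left_commute)
      moreover have "(1 - t) * f x \<le> (1 - t) * (f a - s * (a - x))"
        using t fx by (intro mult_left_mono) auto
      ultimately have "(1 - t) * f x + t * g y \<le> g z" by (simp add: algebra_simps)
      then show ?thesis using xa ay False by simp
    qed
  qed
  then show "(1 - t) * ?h x + t * ?h y \<le> ?h ((1 - t) *\<^sub>R x + t *\<^sub>R y)"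
    unfolding z_def real_scaleR_def .
qed (fact S)

lemma concave_on_powr:
  assumes "0 \<le> p" "p \<le> 1"
  shows "concave_on {0<..} (\<lambda>x::real. x powr p)"
proof (rule f''_le0_imp_concave)
  show "((\<lambda>x. x powr p) has_real_derivative p * x powr (p - 1)) (at x)"
    "((\<lambda>x. p * x powr (p - 1)) has_real_derivative p * ((p - 1) * x powr (p - 2))) (at x)"
    "p * ((p - 1) * x powr (p - 2)) \<le> 0" if "x \<in> {0<..}" for x :: real
    using that assms
    by (auto intro!: derivative_eq_intros simp: mult_nonneg_nonpos mult_nonpos_nonneg)
qed simp

lemma powr_le_tangent:
  assumes "0 < p" "p < 1" "0 \<le> (r::real)"
  shows "r powr p \<le> 1 + p * (r - 1)"
  using Youngs_inequality_0[of p "1 - p" r 1] assms by (cases "r = 0") (auto simp: algebra_simps)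

text \<open>The function that agrees with \<open>f\<close> up to \<open>a\<close> and continues it by the multiple of
  the power \<open>x powr p\<close> that takes the value \<open>f a\<close> at \<open>a\<close>.\<close>

definition power_extension :: "(real \<Rightarrow> real) \<Rightarrow> real \<Rightarrow> real \<Rightarrow> real \<Rightarrow> real" where
  "power_extension f a p x = (if x \<le> a then f x else f a * (x / a) powr p)"

lemma power_extension_le [simp]: "x \<le> a \<Longrightarrow> power_extension f a p x = f x"
  by (simp add: power_extension_def)

lemma power_extension_ge: "0 < a \<Longrightarrow> a \<le> x \<Longrightarrow> power_extension f a p x = f a * (x / a) powr p"
  by (cases "x = a") (auto simp: power_extension_def)

text \<open>The bound on \<open>p\<close> says that the power function has slope at most \<open>s\<close> at \<open>a\<close>, so
  that it stays below the line bounding \<open>f\<close>.\<close>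

lemma concave_on_power_extension:
  assumes a: "0 < a" and f: "concave_on {0..a} f" and fa: "0 \<le> f a"
    and p: "0 < p" "p < 1" "p * f a \<le> s * a"
    and line: "\<And>x. 0 \<le> x \<Longrightarrow> x \<le> a \<Longrightarrow> f x \<le> f a + s * (x - a)"
  shows "concave_on {0..} (power_extension f a p)"
proof -
  let ?g = "\<lambda>x. f a * (x / a) powr p"
  have "concave_on {0..} (\<lambda>x. if x \<le> a then f x else ?g x)"
  proof (rule concave_on_glue[where s = s])
    show "concave_on ({0..} \<inter> {..a}) f"
      using f by (simp add: atLeastAtMost_def)
    have "concave_on {a..} (\<lambda>x. (x / a) powr p)"
    proof
      fix t x y :: real
      assume "0 < t" "t < 1" "x \<in> {a..}" "y \<in> {a..}"
      then show "(1 - t) * (x / a) powr p + t * (y / a) powr p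
          \<le> (((1 - t) *\<^sub>R x + t *\<^sub>R y) / a) powr p"
        using concave_onD[OF concave_on_powr[of p], of t "x / a" "y / a"] p a
        by (simp add: add_divide_distrib)
    qed simp
    then have "concave_on {a..} ?g"
      using fa by (rule concave_on_cmul[rotated])
    moreover have "{0..} \<inter> {a..} = {a..}" using a by auto
    ultimately show "concave_on ({0..} \<inter> {a..}) ?g" by simp
  next
    fix x assume x: "x \<in> {0..}" "a \<le> x"
    have "(x / a) powr p \<le> 1 + p * (x / a - 1)"
      using x a p by (intro powr_le_tangent) auto
    then have "?g x \<le> f a * (1 + p * (x / a - 1))"
      using fa by (rule mult_left_mono)
    also have "\<dots> = f a + (p * f a) * ((x - a) / a)"
      using a by (simp add: field_simps)
    also have "\<dots> \<le> f a + (s * a) * ((x - a) / a)"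
      using p(3) x a by (intro add_left_mono mult_right_mono) auto
    finally show "?g x \<le> f a + s * (x - a)" using a by simp
  qed (use a line in auto)
  then show ?thesis by (simp add: power_extension_def[abs_def])
qed

lemma homeomorphism_power_extension:
  assumes a: "0 < a" and fa: "0 < f a" and p: "0 < p"
    and hom: "homeomorphism {0..a} {0..f a} f g" and ga: "g (f a) = a"
  shows "homeomorphism {0..} {0..} (power_extension f a p) (power_extension g (f a) (1 / p))"
proof -
  \<comment> \<open>The hypotheses are symmetric in the two maps, up to replacing \<open>p\<close> by its inverse.\<close>
  have cont: "continuous_on {0..} (power_extension h b q)"
    if "0 < b" "continuous_on {0..b} h" for h :: "real \<Rightarrow> real" and b q :: real
  proof -
    have "{x \<in> {0..}. x \<le> b} = {0..b}" by auto
    then show ?thesis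
      unfolding power_extension_def[abs_def]
      using that
      by (intro continuous_on_cases_le) (simp_all, auto intro!: continuous_intros)
  qed
  have inverse: "power_extension k (h b) (1 / q) (power_extension h b q x) = x \<and>
      power_extension h b q x \<in> {0..}"
    if b: "0 < b" "0 < h b" "0 < q" and hk: "homeomorphism {0..b} {0..h b} h k"
      and kb: "k (h b) = b" and x: "x \<in> {0..}" for h k b q x
  proof (cases "x \<le> b")
    case True
    then have "h x \<in> {0..h b}" "k (h x) = x"
      using hk x by (auto simp: homeomorphism_def)
    then show ?thesis using True by simp
  next
    case False
    then have "1 \<le> (x / b) powr q" using b by (intro ge_one_powr_ge_zero) auto
    then have "h b \<le> h b * (x / b) powr q" using b by simp
    then show ?thesis using False b kb x
      by (simp add: power_extension_ge powr_powr)
  qed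
  have hom': "homeomorphism {0..f a} {0..g (f a)} g f"
    using hom unfolding ga by (rule homeomorphism_symD)
  have inv_f: "power_extension g (f a) (1 / p) (power_extension f a p x) = x"
    "power_extension f a p x \<in> {0..}" if "x \<in> {0..}" for x
    using inverse[OF a fa p hom ga that] by auto
  have inv_g: "power_extension f a p (power_extension g (f a) (1 / p) y) = y"
    "power_extension g (f a) (1 / p) y \<in> {0..}" if "y \<in> {0..}" for y
    using inverse[of "f a" g "1 / p" f y] fa a p hom' ga that by simp_all
  show ?thesis
  proof
    show "continuous_on {0..} (power_extension f a p)"
      using hom a by (intro cont) (auto simp: homeomorphism_def)
    show "continuous_on {0..} (power_extension g (f a) (1 / p))"
      using hom fa by (intro cont) (auto simp: homeomorphism_def)
    show "power_extension f a p ` {0..} \<subseteq> {0..}" by (intro image_subsetI inv_f(2))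
    show "power_extension g (f a) (1 / p) ` {0..} \<subseteq> {0..}" by (intro image_subsetI inv_g(2))
  qed (fact inv_f(1) inv_g(1))+
qed

section \<open>Tameness of the extension\<close>

text \<open>For every \<open>x > 0\<close> one of the two factors of \<open>Q (u * u) x\<close> is controlled: the first
  one by \<open>small\<close> if \<open>u * x < a\<close>, the second one by \<open>large\<close> otherwise.  The other factor is at
  most 1.\<close>

lemma tendsto_SUP_cocycle:
  fixes Q :: "real \<Rightarrow> real \<Rightarrow> real" and S :: "real \<Rightarrow> ereal"
  assumes c: "0 < c"
    and S: "(S \<longlongrightarrow> 0) (at_right 0)"
    and cocycle: "\<And>u x. 0 < u \<Longrightarrow> u < 1 \<Longrightarrow> 0 < x \<Longrightarrow> Q (u * u) x = Q u (u * x) * Q u x"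
    and Q: "\<And>u x. 0 < u \<Longrightarrow> u < 1 \<Longrightarrow> 0 < x \<Longrightarrow> 0 \<le> Q u x \<and> Q u x \<le> 1"
    and small: "\<And>u x. 0 < u \<Longrightarrow> u < 1 \<Longrightarrow> 0 < x \<Longrightarrow> x < a \<Longrightarrow> ereal (Q u x) \<le> S u"
    and large: "\<And>u x. 0 < u \<Longrightarrow> u < 1 \<Longrightarrow> a \<le> u * x \<Longrightarrow> Q u x = u powr c"
  shows "((\<lambda>t. SUP x\<in>{0<..}. ereal (Q t x)) \<longlongrightarrow> 0) (at_right 0)"
proof (rule tendsto_sandwich)
  let ?B = "\<lambda>t. max (S (sqrt t)) (ereal (sqrt t powr c))"
  have ev: "\<forall>\<^sub>F t in at_right 0. 0 < t \<and> t < (1::real)"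
    by (auto simp: eventually_at_right_field intro: exI[of _ 1])
  show "\<forall>\<^sub>F t in at_right 0. 0 \<le> (SUP x\<in>{0<..}. ereal (Q t x))"
    using ev
  proof eventually_elim
    case (elim t)
    then have "0 \<le> ereal (Q t 1)" using Q[of t 1] by simp
    also have "\<dots> \<le> (SUP x\<in>{0<..}. ereal (Q t x))" by (rule SUP_upper) simp
    finally show ?case .
  qed
  show "\<forall>\<^sub>F t in at_right 0. (SUP x\<in>{0<..}. ereal (Q t x)) \<le> ?B t"
    using ev
  proof eventually_elim
    case (elim t)
    define u where "u = sqrt t"
    have u: "0 < u" "u < 1" and t: "t = u * u" using elim by (auto simp: u_def)
    show ?case
    proof (rule SUP_least)
      fix x :: real assume "x \<in> {0<..}"
      then have x: "0 < x" by simp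
      note q = Q[OF u x] Q[OF u mult_pos_pos[OF u(1) x]]
      have "Q t x = Q u (u * x) * Q u x" unfolding t by (rule cocycle[OF u x])
      then have le: "Q t x \<le> Q u (u * x)" "Q t x \<le> Q u x"
        using q by (auto intro: mult_left_le mult_left_le_one_le)
      show "ereal (Q t x) \<le> ?B t"
      proof (cases "u * x < a")
        case True
        have "ereal (Q t x) \<le> ereal (Q u (u * x))" using le by simp
        also have "\<dots> \<le> S u" using True u x by (intro small) auto
        finally show ?thesis by (simp add: u_def le_max_iff_disj)
      next
        case False
        then show ?thesis using le large[OF u, of x] by (simp add: u_def le_max_iff_disj)
      qed
    qed
  qed
  have sq: "filterlim sqrt (at_right 0) (at_right 0)"
  proof -
    have "(sqrt \<longlongrightarrow> sqrt 0) (at_right 0)" by (intro tendsto_intros)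
    then show ?thesis
      by (auto simp: filterlim_at eventually_at_right_field intro: exI[of _ 1])
  qed
  have "((\<lambda>t. sqrt t powr c) \<longlongrightarrow> 0) (at_right 0)"
  proof -
    have "((\<lambda>t. sqrt t powr c) \<longlongrightarrow> sqrt 0 powr c) (at_right 0)"
    proof (rule tendsto_powr')
      show "(sqrt \<longlongrightarrow> sqrt 0) (at_right 0)" by (intro tendsto_intros)
      show "sqrt 0 \<noteq> 0 \<or> 0 < c \<and> (\<forall>\<^sub>F t in at_right 0. 0 \<le> sqrt t)"
        using c by (auto intro: eventually_mono[OF ev])
    qed simp
    then show ?thesis by simp
  qed
  then have "((\<lambda>t. ereal (sqrt t powr c)) \<longlongrightarrow> 0) (at_right 0)"
    unfolding zero_ereal_def by (rule tendsto_ereal)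
  from tendsto_max[OF filterlim_compose[OF S sq] this]
  show "(?B \<longlongrightarrow> 0) (at_right 0)" by simp
qed simp

section \<open>Concave homeomorphisms of half-open intervals\<close>

text \<open>The map takes the value 0 somewhere and is nonnegative.  A zero at an interior point
  would force a positive value at 0, by injectivity, and concavity would then make the map positive
  at that point.  So the zero is at 0, and a descent would violate injectivity by the intermediate
  value theorem.\<close>

lemma homeomorphism_half_open_increasing:
  fixes \<alpha> :: "real \<Rightarrow> real"
  assumes d: "0 < d" and hom: "homeomorphism {0..<d} {0..<e} \<alpha> \<gamma>" and conc: "concave_on {0..<d} \<alpha>"
  shows "\<alpha> 0 = 0" and "strict_mono_on {0..<d} \<alpha>"
proof -
  have inj: "inj_on \<alpha> {0..<d}" 
    using hom by (intro inj_on_inverseI[of _ \<gamma>]) (auto simp: homeomorphism_def)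
  have cont: "continuous_on {0..<d} \<alpha>" using hom by (simp add: homeomorphism_def)
  have img: "\<alpha> ` {0..<d} = {0..<e}" using hom by (simp add: homeomorphism_def)
  have nn: "0 \<le> \<alpha> x" if "0 \<le> x" "x < d" for x
    using img that by (metis atLeastLessThan_iff imageI)
  show 0: "\<alpha> 0 = 0"
  proof -
    have "0 < e" using nn[of 0] img d by (metis atLeastLessThan_iff dual_order.refl imageI le_less_trans)
    then obtain z where z: "0 \<le> z" "z < d" "\<alpha> z = 0"
      using img by (metis atLeastLessThan_iff dual_order.refl imageE)
    have "z = 0"
    proof (rule ccontr)
      assume "z \<noteq> 0"
      then have "0 < z" using z by simp
      define y where "y = (z + d) / 2"
      have y: "z < y" "y < d" using z by (auto simp: y_def)
      have "\<alpha> 0 \<noteq> 0" using inj_onD[OF inj, of 0 z] z \<open>0 < z\<close> d by auto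
      then have "0 < \<alpha> 0" using nn[of 0] d by simp
      define t where "t = z / y"
      have t: "0 < t" "t < 1" using \<open>0 < z\<close> y by (auto simp: t_def)
      have "(1 - t) * \<alpha> 0 + t * \<alpha> y \<le> \<alpha> z"
        using concave_onD[OF conc, of t 0 y] t y \<open>0 < z\<close> d by (simp add: t_def)
      moreover have "0 < (1 - t) * \<alpha> 0" "0 \<le> t * \<alpha> y"
        using t \<open>0 < \<alpha> 0\<close> nn[of y] y \<open>0 < z\<close> by auto
      ultimately show False using z by simp
    qed
    then show ?thesis using z by simp
  qed
  show "strict_mono_on {0..<d} \<alpha>"
  proof (rule strict_mono_onI, rule ccontr)
    fix x y assume xy: "x \<in> {0..<d}" "y \<in> {0..<d}" "x < y" and n: "\<not> \<alpha> x < \<alpha> y"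
    have "\<alpha> y \<noteq> \<alpha> x" using inj_onD[OF inj, of y x] xy by auto
    then have "\<alpha> y < \<alpha> x" using n by simp
    moreover have "continuous_on {0..x} \<alpha>" using cont xy by (auto intro: continuous_on_subset)
    ultimately obtain u where "0 \<le> u" "u \<le> x" "\<alpha> u = \<alpha> y"
      using IVT'[of \<alpha> 0 "\<alpha> y" x] 0 nn[of y] xy by auto
    then show False using inj_onD[OF inj, of u y] xy by auto
  qed
qed

section \<open>Extension of germs to tame concave moduli\<close>

theorem lemma2p10:
  fixes \<delta> \<alpha>\<delta> :: real and \<alpha> :: "real \<Rightarrow> real"
  assumes "\<delta> > 0"
    and "(\<alpha> \<longlongrightarrow> \<alpha>\<delta>) (at_left \<delta>)"
    and "\<exists>\<gamma>. homeomorphism {0..<\<delta>} {0..<\<alpha>\<delta>} \<alpha> \<gamma>"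
    and "concave_on {0..<\<delta>} \<alpha>"
  shows "(\<exists>\<beta>. concave_modulus \<beta> \<and> same_germs_at_0 \<alpha> \<beta>)
    \<and> (((\<lambda>t. SUP x\<in>{0<..<\<delta>}. ereal (t * \<alpha> x / \<alpha> (t * x))) \<longlongrightarrow> 0) (at_right 0) \<longrightarrow>
         (\<exists>\<beta>. sup_tame_modulus \<beta> \<and> same_germs_at_0 \<alpha> \<beta>))
    \<and> (((\<lambda>t. SUP x\<in>{0<..<\<delta>}. ereal (\<alpha> (t * x) / \<alpha> x)) \<longlongrightarrow> 0) (at_right 0) \<longrightarrow>
         (\<exists>\<beta>. sub_tame_modulus \<beta> \<and> same_germs_at_0 \<alpha> \<beta>))"
proof -
  obtain \<gamma> where hom: "homeomorphism {0..<\<delta>} {0..<\<alpha>\<delta>} \<alpha> \<gamma>" using assms(3) by blast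
  note \<alpha>0 = homeomorphism_half_open_increasing(1)[OF assms(1) hom assms(4)]
  note smono = homeomorphism_half_open_increasing(2)[OF assms(1) hom assms(4)]
  have less: "\<alpha> x < \<alpha> y" if "0 \<le> x" "x < y" "y < \<delta>" for x y
    using smono that by (auto simp: strict_mono_on_def)
  then have le: "\<alpha> x \<le> \<alpha> y" if "0 \<le> x" "x \<le> y" "y < \<delta>" for x y
    using that by (cases "x = y") (auto simp: less_imp_le)
  define a b where "a = \<delta> / 3" and "b = 2 * \<delta> / 3"
  have ab: "0 < a" "a < b" "b < \<delta>" using assms(1) by (auto simp: a_def b_def)
  have fa: "0 < \<alpha> a" using less[of 0 a] ab \<alpha>0 by simp
  define s where "s = (\<alpha> b - \<alpha> a) / (b - a)"
  have s: "0 < s" using less[of a b] ab by (simp add: s_def)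
  \<comment> \<open>The minimum with \<open>1 / 2\<close> ensures \<open>p < 1\<close>; the other term is the bound on the slope at \<open>a\<close>.\<close>
  define p where "p = min (1 / 2) (s * a / \<alpha> a)"
  have p: "0 < p" "p < 1" "p * \<alpha> a \<le> s * a"
    using s ab fa by (auto simp: p_def min_def field_simps)
  define \<beta> where "\<beta> = power_extension \<alpha> a p"
  have conc: "concave_on {0..} \<beta>"
    unfolding \<beta>_def
  proof (rule concave_on_power_extension[where s = s])
    show "concave_on {0..a} \<alpha>"
      using assms(4) ab unfolding concave_on_def by (auto intro: convex_on_subset)
    \<comment> \<open>To the left of \<open>a\<close>, concavity puts \<open>\<alpha>\<close> below the line extending its secant over \<open>[a, b]\<close>.\<close>
    fix x assume x: "0 \<le> x" "x \<le> a"
    have "(\<alpha> b - \<alpha> x) / (b - x) * (a - x) + \<alpha> x \<le> \<alpha> a"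
    proof (rule concave_onD_Icc')
      show "concave_on {x..b} \<alpha>"
        using assms(4) ab x unfolding concave_on_def by (auto intro: convex_on_subset)
    qed (use x ab in auto)
    then have "(\<alpha> b - \<alpha> x) * (a - x) \<le> (\<alpha> a - \<alpha> x) * (b - x)"
      using x ab by (simp add: field_simps)
    then have "(\<alpha> b - \<alpha> a) * (a - x) \<le> (\<alpha> a - \<alpha> x) * (b - a)"
      by (simp add: algebra_simps)
    then have "s * (a - x) \<le> \<alpha> a - \<alpha> x"
      using ab by (simp add: s_def field_simps)
    then show "\<alpha> x \<le> \<alpha> a + s * (x - a)" by (simp add: algebra_simps)
  qed (use ab fa p in auto)
  have "\<alpha> ` {0..a} = {0..\<alpha> a}"
  proof
    show "\<alpha> ` {0..a} \<subseteq> {0..\<alpha> a}"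
      using le[of 0] le[of _ a] ab \<alpha>0 by auto
    show "{0..\<alpha> a} \<subseteq> \<alpha> ` {0..a}"
    proof
      fix y assume "y \<in> {0..\<alpha> a}"
      moreover have "continuous_on {0..a} \<alpha>"
        using hom ab by (auto simp: homeomorphism_def intro: continuous_on_subset)
      ultimately show "y \<in> \<alpha> ` {0..a}" using IVT'[of \<alpha> 0 y a] \<alpha>0 ab by auto
    qed
  qed
  then have "homeomorphism {0..a} {0..\<alpha> a} \<alpha> \<gamma>"
    using less[of a b] ab hom
    by (intro homeomorphism_of_subsets[OF hom]) (auto simp: homeomorphism_def)
  moreover have "\<gamma> (\<alpha> a) = a" using hom ab by (auto simp: homeomorphism_def)
  ultimately have mod: "concave_modulus \<beta>"
    using homeomorphism_power_extension[of a \<alpha> p \<gamma>] ab fa p conc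
    by (auto simp: concave_modulus_def \<beta>_def)
  have germs: "same_germs_at_0 \<alpha> \<beta>"
    using ab by (auto simp: same_germs_at_0_def \<beta>_def intro!: exI[of _ a])
  have \<beta>0: "\<beta> 0 = 0" using ab \<alpha>0 by (simp add: \<beta>_def)
  have pos: "0 < \<beta> x" if "0 < x" for x
    using that ab fa less[of 0 x] \<alpha>0 by (auto simp: \<beta>_def power_extension_def)
  have mono: "\<beta> x \<le> \<beta> y" if "0 \<le> x" "x \<le> y" for x y
  proof -
    consider "y \<le> a" | "x \<le> a" "a < y" | "a < x" using that by linarith
    then show ?thesis
    proof cases
      case 1
      then show ?thesis using that le[of x y] ab by (simp add: \<beta>_def)
    next
      case 2
      then have "1 \<le> (y / a) powr p" using ab p by (intro ge_one_powr_ge_zero) auto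
      then have "\<alpha> a \<le> \<alpha> a * (y / a) powr p" using fa by simp
      moreover have "\<alpha> x \<le> \<alpha> a" using le[of x a] 2 that ab by simp
      ultimately show ?thesis using 2 by (simp add: \<beta>_def power_extension_def)
    next
      case 3
      then show ?thesis using that ab fa p
        by (auto simp: \<beta>_def power_extension_def intro!: powr_mono2 divide_right_mono)
    qed
  qed
  \<comment> \<open>Concavity between 0 and \<open>x\<close>, using \<open>\<beta> 0 = 0\<close>.\<close>
  have star: "u * \<beta> x \<le> \<beta> (u * x)" if "0 < u" "u < 1" "0 < x" for u x
    using concave_onD[OF conc, of u 0 x] that \<beta>0 by simp
  have scale: "\<beta> (u * x) = u powr p * \<beta> x" if "0 < u" "u < 1" "a \<le> u * x" for u x
  proof -
    have "0 < x" using that ab zero_less_mult_pos[of u x] by simp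
    then have "u * x \<le> x" using that by (intro mult_left_le_one_le) auto
    then have "a \<le> x" using that by linarith
    then show ?thesis using that ab \<open>0 < x\<close> powr_mult[of u "x / a" p]
      by (simp add: \<beta>_def power_extension_ge)
  qed
  have "sup_tame_modulus \<beta>"
    if lim: "((\<lambda>t. SUP x\<in>{0<..<\<delta>}. ereal (t * \<alpha> x / \<alpha> (t * x))) \<longlongrightarrow> 0) (at_right 0)"
    unfolding sup_tame_modulus_def
  proof (intro conjI mod tendsto_SUP_cocycle[where a = a and c = "1 - p", OF _ lim])
    fix u x :: real assume u: "0 < u" "u < 1"
    {
      assume x: "0 < x"
      show "u * u * \<beta> x / \<beta> (u * u * x) = u * \<beta> (u * x) / \<beta> (u * (u * x)) * (u * \<beta> x / \<beta> (u * x))"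
        using pos[of "u * x"] u x by (simp add: mult.assoc)
      show "0 \<le> u * \<beta> x / \<beta> (u * x)" "u * \<beta> x / \<beta> (u * x) \<le> 1"
        using star[OF u x] pos[of "u * x"] pos[OF x] u x by auto
      assume "x < a"
      moreover from this have "u * x < a" using u x by (intro le_less_trans[OF mult_left_le_one_le]) auto
      ultimately have "u * \<beta> x / \<beta> (u * x) = u * \<alpha> x / \<alpha> (u * x)" by (simp add: \<beta>_def)
      then show "ereal (u * \<beta> x / \<beta> (u * x)) \<le> (SUP x\<in>{0<..<\<delta>}. ereal (u * \<alpha> x / \<alpha> (u * x)))"
        using x \<open>x < a\<close> ab by (auto intro: SUP_upper)
    }
    assume "a \<le> u * x"
    moreover from this have "0 < \<beta> x" using ab u zero_less_mult_pos[of u x] by (intro pos) simp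
    ultimately show "u * \<beta> x / \<beta> (u * x) = u powr (1 - p)"
      using u by (simp add: scale powr_diff)
  qed (use p in simp)
  moreover have "sub_tame_modulus \<beta>"
    if lim: "((\<lambda>t. SUP x\<in>{0<..<\<delta>}. ereal (\<alpha> (t * x) / \<alpha> x)) \<longlongrightarrow> 0) (at_right 0)"
    unfolding sub_tame_modulus_def
  proof (intro conjI mod tendsto_SUP_cocycle[where a = a and c = p, OF _ lim])
    fix u x :: real assume u: "0 < u" "u < 1"
    {
      assume x: "0 < x"
      show "\<beta> (u * u * x) / \<beta> x = \<beta> (u * (u * x)) / \<beta> (u * x) * (\<beta> (u * x) / \<beta> x)"
        using pos[of "u * x"] u x by (simp add: mult.assoc)
      show "0 \<le> \<beta> (u * x) / \<beta> x" "\<beta> (u * x) / \<beta> x \<le> 1"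
        using mono[of "u * x" x] pos[of "u * x"] pos[OF x] u x by auto
      assume "x < a"
      moreover from this have "u * x < a" using u x by (intro le_less_trans[OF mult_left_le_one_le]) auto
      ultimately have "\<beta> (u * x) / \<beta> x = \<alpha> (u * x) / \<alpha> x" by (simp add: \<beta>_def)
      then show "ereal (\<beta> (u * x) / \<beta> x) \<le> (SUP x\<in>{0<..<\<delta>}. ereal (\<alpha> (u * x) / \<alpha> x))"
        using x \<open>x < a\<close> ab by (auto intro: SUP_upper)
    }
    assume "a \<le> u * x"
    moreover from this have "0 < \<beta> x" using ab u zero_less_mult_pos[of u x] by (intro pos) simp
    ultimately show "\<beta> (u * x) / \<beta> x = u powr p"
      using u by (simp add: scale)
  qed (use p in simp)
  ultimately show ?thesis using mod germs by blast
qed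

end
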